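(* Every selector-free first-order formula over a (co)datatype signature can be effectively transformed into a formula over the corresponding tree signature (same sorts, the constructors as generators, and predicates $\mathrm{fin}_s$) that is equisatisfiable with it, where satisfiability of the former is with respect to structures of (co)datatypes and of the latter with respect to the structure $\mathcal T$ of trees (extended theory of trees).
   Context: A (co)datatype signature: sorts partitioned into datatypes and codatatypes; each (co)datatype has at least one constructor $C:\delta_1\times\cdots\times\delta_n\to\delta$ (with associated selectors); constructor arguments of datatypes are datatypes, of codatatypes are codatatypes; every datatype has a ground constructor term. A structure of (co)datatypes interprets each codatatype as the set of all (finite or infinite) constructor trees of that sort, each datatype as the set of finite constructor trees of that sort, and constructors as tree-building operations (a constructor tree of sort $\delta$ is a rooted ordered possibly infinite tree whose root is labeled by a constructor $C:\delta_1\times\cdots\times\delta_n\to\delta$ and whose children in order are constructor trees of sorts $\delta_1,\dots,\delta_n$). The structure $\mathcal T$ of trees for a many-sorted signature with sorts $S$, generators $f: s_1\times\cdots\times s_n\to s$ and predicates $\mathrm{fin}_s$ ($s\in S$) interprets each sort $s$ as the set of all (finite or infinite) trees of sort $s$ (defined as constructor trees above, labeled by generators), each generator as the corresponding tree-building function, and $\mathrm{fin}_s$ as the set of finite trees of sort $s$. The extended theory of trees is the set of sentences true in $\mathcal T$. *)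

theory Defs
  imports Main "HOL-Library.Nat_Bijection"
begin

section \<open>Many-sorted first-order logic with equality\<close>

text \<open>The partition of the sorts into datatypes and codatatypes is recorded in the sort symbol, so
  that it is part of what an algorithm reading a formula can see.\<close>

datatype sort = is_data: Data nat | is_codata: Codata nat

datatype (funs_trm: 'f) trm = Var sort nat | Fn 'f "'f trm list"

datatype (funs_fm: 'f, preds_fm: 'p) fm =
    Falsum
  | Eq "'f trm" "'f trm"
  | Pred 'p "'f trm list"
  | Neg "('f, 'p) fm"
  | Conj "('f, 'p) fm" "('f, 'p) fm"
  | Disj "('f, 'p) fm" "('f, 'p) fm"
  | Impl "('f, 'p) fm" "('f, 'p) fm"
  | Forall sort nat "('f, 'p) fm"
  | Exists sort nat "('f, 'p) fm"

record ('f, 'p) signature =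
  sorts :: "sort set"
  funs :: "'f set"
  fun_args :: "'f \<Rightarrow> sort list"
  fun_res :: "'f \<Rightarrow> sort"
  preds :: "'p set"
  pred_args :: "'p \<Rightarrow> sort list"

inductive has_sort :: "('f, 'p) signature \<Rightarrow> sort \<Rightarrow> 'f trm \<Rightarrow> bool" for L where
  "s \<in> sorts L \<Longrightarrow> has_sort L s (Var s x)"
| "f \<in> funs L \<Longrightarrow> list_all2 (has_sort L) (fun_args L f) ts \<Longrightarrow> has_sort L (fun_res L f) (Fn f ts)"

primrec formula_over :: "('f, 'p) signature \<Rightarrow> ('f, 'p) fm \<Rightarrow> bool" where
  "formula_over L Falsum \<longleftrightarrow> True"
| "formula_over L (Eq t u) \<longleftrightarrow> (\<exists>s. has_sort L s t \<and> has_sort L s u)"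
| "formula_over L (Pred p ts) \<longleftrightarrow> p \<in> preds L \<and> list_all2 (has_sort L) (pred_args L p) ts"
| "formula_over L (Neg \<phi>) \<longleftrightarrow> formula_over L \<phi>"
| "formula_over L (Conj \<phi> \<psi>) \<longleftrightarrow> formula_over L \<phi> \<and> formula_over L \<psi>"
| "formula_over L (Disj \<phi> \<psi>) \<longleftrightarrow> formula_over L \<phi> \<and> formula_over L \<psi>"
| "formula_over L (Impl \<phi> \<psi>) \<longleftrightarrow> formula_over L \<phi> \<and> formula_over L \<psi>"
| "formula_over L (Forall s x \<phi>) \<longleftrightarrow> s \<in> sorts L \<and> formula_over L \<phi>"
| "formula_over L (Exists s x \<phi>) \<longleftrightarrow> s \<in> sorts L \<and> formula_over L \<phi>"

record ('f, 'p, 'u) struct =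
  universe :: "sort \<Rightarrow> 'u set"
  fun_interp :: "'f \<Rightarrow> 'u list \<Rightarrow> 'u"
  pred_interp :: "'p \<Rightarrow> 'u list \<Rightarrow> bool"

type_synonym 'u assignment = "sort \<Rightarrow> nat \<Rightarrow> 'u"

definition assignment_into ::
  "('f, 'p) signature \<Rightarrow> ('f, 'p, 'u) struct \<Rightarrow> 'u assignment \<Rightarrow> bool" where
  "assignment_into L A v \<longleftrightarrow> (\<forall>s\<in>sorts L. \<forall>x. v s x \<in> universe A s)"

primrec eval_trm :: "('f, 'p, 'u) struct \<Rightarrow> 'u assignment \<Rightarrow> 'f trm \<Rightarrow> 'u" where
  "eval_trm A v (Var s x) = v s x"
| "eval_trm A v (Fn f ts) = fun_interp A f (map (eval_trm A v) ts)"

definition upd :: "'u assignment \<Rightarrow> sort \<Rightarrow> nat \<Rightarrow> 'u \<Rightarrow> 'u assignment" where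
  "upd v s x a = v(s := (v s)(x := a))"

primrec sat :: "('f, 'p, 'u) struct \<Rightarrow> 'u assignment \<Rightarrow> ('f, 'p) fm \<Rightarrow> bool" where
  "sat A v Falsum \<longleftrightarrow> False"
| "sat A v (Eq t u) \<longleftrightarrow> eval_trm A v t = eval_trm A v u"
| "sat A v (Pred p ts) \<longleftrightarrow> pred_interp A p (map (eval_trm A v) ts)"
| "sat A v (Neg \<phi>) \<longleftrightarrow> \<not> sat A v \<phi>"
| "sat A v (Conj \<phi> \<psi>) \<longleftrightarrow> sat A v \<phi> \<and> sat A v \<psi>"
| "sat A v (Disj \<phi> \<psi>) \<longleftrightarrow> sat A v \<phi> \<or> sat A v \<psi>"
| "sat A v (Impl \<phi> \<psi>) \<longleftrightarrow> (sat A v \<phi> \<longrightarrow> sat A v \<psi>)"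
| "sat A v (Forall s x \<phi>) \<longleftrightarrow> (\<forall>a\<in>universe A s. sat A (upd v s x a) \<phi>)"
| "sat A v (Exists s x \<phi>) \<longleftrightarrow> (\<exists>a\<in>universe A s. sat A (upd v s x a) \<phi>)"

definition satisfiable_in ::
  "('f, 'p) signature \<Rightarrow> ('f, 'p, 'u) struct \<Rightarrow> ('f, 'p) fm \<Rightarrow> bool" where
  "satisfiable_in L A \<phi> \<longleftrightarrow> (\<exists>v. assignment_into L A v \<and> sat A v \<phi>)"


section \<open>(Co)datatype signatures and tree signatures\<close>

record ctor_sig =
  csorts :: "sort set"
  ctors :: "nat set"
  ctor_args :: "nat \<Rightarrow> sort list"
  ctor_res :: "nat \<Rightarrow> sort"

text \<open>\<^term>\<open>Sel c i\<close> is the selector of the \<open>i\<close>-th argument (counted from 0) of the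
  constructor \<open>c\<close>.\<close>

datatype cd_fun = Ctor nat | Sel nat nat

text \<open>The predicate symbol type is \<^typ>\<open>unit\<close> only because HOL types are nonempty;
  there are no predicate symbols besides equality.\<close>

definition cd_language :: "ctor_sig \<Rightarrow> (cd_fun, unit) signature" where
  "cd_language \<Sigma> =
     \<lparr> sorts = csorts \<Sigma>,
       funs = Ctor ` ctors \<Sigma> \<union> {Sel c i | c i. c \<in> ctors \<Sigma> \<and> i < length (ctor_args \<Sigma> c)},
       fun_args = (\<lambda>f. case f of Ctor c \<Rightarrow> ctor_args \<Sigma> c | Sel c i \<Rightarrow> [ctor_res \<Sigma> c]),
       fun_res = (\<lambda>f. case f of Ctor c \<Rightarrow> ctor_res \<Sigma> c | Sel c i \<Rightarrow> ctor_args \<Sigma> c ! i),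
       preds = {},
       pred_args = (\<lambda>_. []) \<rparr>"

text \<open>The predicate symbol \<open>s\<close> of the tree language stands for \<open>fin\<^sub>s\<close>.\<close>

definition tree_language :: "ctor_sig \<Rightarrow> (nat, sort) signature" where
  "tree_language \<Sigma> =
     \<lparr> sorts = csorts \<Sigma>,
       funs = ctors \<Sigma>,
       fun_args = ctor_args \<Sigma>,
       fun_res = ctor_res \<Sigma>,
       preds = csorts \<Sigma>,
       pred_args = (\<lambda>s. [s]) \<rparr>"

definition selector_free :: "(cd_fun, 'p) fm \<Rightarrow> bool" where
  "selector_free \<phi> \<longleftrightarrow> (\<forall>c i. Sel c i \<notin> funs_fm \<phi>)"

primrec ground :: "'f trm \<Rightarrow> bool" where
  "ground (Var s x) \<longleftrightarrow> False"
| "ground (Fn f ts) \<longleftrightarrow> list_all ground ts"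

definition ground_ctor_term :: "ctor_sig \<Rightarrow> sort \<Rightarrow> cd_fun trm \<Rightarrow> bool" where
  "ground_ctor_term \<Sigma> s t \<longleftrightarrow>
     has_sort (cd_language \<Sigma>) s t \<and> ground t \<and> funs_trm t \<subseteq> range Ctor"

definition cd_signature :: "ctor_sig \<Rightarrow> bool" where
  "cd_signature \<Sigma> \<longleftrightarrow>
     (\<forall>c\<in>ctors \<Sigma>. ctor_res \<Sigma> c \<in> csorts \<Sigma> \<and> set (ctor_args \<Sigma> c) \<subseteq> csorts \<Sigma>) \<and>
     (\<forall>s\<in>csorts \<Sigma>. \<exists>c\<in>ctors \<Sigma>. ctor_res \<Sigma> c = s) \<and>
     (\<forall>c\<in>ctors \<Sigma>. is_data (ctor_res \<Sigma> c) \<longrightarrow> (\<forall>s\<in>set (ctor_args \<Sigma> c). is_data s)) \<and>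
     (\<forall>c\<in>ctors \<Sigma>. is_codata (ctor_res \<Sigma> c) \<longrightarrow> (\<forall>s\<in>set (ctor_args \<Sigma> c). is_codata s)) \<and>
     (\<forall>s\<in>csorts \<Sigma>. is_data s \<longrightarrow> (\<exists>t. ground_ctor_term \<Sigma> s t))"


section \<open>Trees and the intended structures\<close>

codatatype ctree = Node (root: nat) (children: "ctree list")

coinductive tree_of_sort :: "ctor_sig \<Rightarrow> sort \<Rightarrow> ctree \<Rightarrow> bool" for \<Sigma> where
  "c \<in> ctors \<Sigma> \<Longrightarrow> list_all2 (tree_of_sort \<Sigma>) (ctor_args \<Sigma> c) ts \<Longrightarrow>
     tree_of_sort \<Sigma> (ctor_res \<Sigma> c) (Node c ts)"

text \<open>The nodes of a tree, given as paths from the root.\<close>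

inductive is_node :: "ctree \<Rightarrow> nat list \<Rightarrow> bool" where
  "is_node t []"
| "i < length ts \<Longrightarrow> is_node (ts ! i) p \<Longrightarrow> is_node (Node c ts) (i # p)"

definition finite_tree :: "ctree \<Rightarrow> bool" where
  "finite_tree t \<longleftrightarrow> finite {p. is_node t p}"

text \<open>Structures of (co)datatypes differ only in the values of selectors on trees built by a
  different constructor, which are arbitrary elements of the right sort.\<close>

definition cd_structure :: "ctor_sig \<Rightarrow> (cd_fun, unit, ctree) struct \<Rightarrow> bool" where
  "cd_structure \<Sigma> A \<longleftrightarrow>
     (\<forall>s\<in>csorts \<Sigma>. is_codata s \<longrightarrow> universe A s = {t. tree_of_sort \<Sigma> s t}) \<and>
     (\<forall>s\<in>csorts \<Sigma>. is_data s \<longrightarrow> universe A s = {t. tree_of_sort \<Sigma> s t \<and> finite_tree t}) \<and>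
     (\<forall>c\<in>ctors \<Sigma>. \<forall>ts. list_all2 (\<lambda>s t. t \<in> universe A s) (ctor_args \<Sigma> c) ts \<longrightarrow>
        fun_interp A (Ctor c) ts = Node c ts) \<and>
     (\<forall>c\<in>ctors \<Sigma>. \<forall>i<length (ctor_args \<Sigma> c). \<forall>t\<in>universe A (ctor_res \<Sigma> c).
        fun_interp A (Sel c i) [t] \<in> universe A (ctor_args \<Sigma> c ! i) \<and>
        (root t = c \<longrightarrow> fun_interp A (Sel c i) [t] = children t ! i))"

definition tree_structure :: "ctor_sig \<Rightarrow> (nat, sort, ctree) struct" where
  "tree_structure \<Sigma> =
     \<lparr> universe = (\<lambda>s. {t. tree_of_sort \<Sigma> s t}),
       fun_interp = Node,
       pred_interp = (\<lambda>s ts. \<exists>t. ts = [t] \<and> tree_of_sort \<Sigma> s t \<and> finite_tree t) \<rparr>"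

definition cd_satisfiable :: "ctor_sig \<Rightarrow> (cd_fun, unit) fm \<Rightarrow> bool" where
  "cd_satisfiable \<Sigma> \<phi> \<longleftrightarrow> (\<exists>A. cd_structure \<Sigma> A \<and> satisfiable_in (cd_language \<Sigma>) A \<phi>)"

definition tree_satisfiable :: "ctor_sig \<Rightarrow> (nat, sort) fm \<Rightarrow> bool" where
  "tree_satisfiable \<Sigma> \<psi> \<longleftrightarrow> satisfiable_in (tree_language \<Sigma>) (tree_structure \<Sigma>) \<psi>"


section \<open>Effectiveness\<close>

text \<open>Kleene's partial recursive functions; \<^term>\<open>Rec f g\<close> and \<^term>\<open>Mu f\<close>
  recurse on, respectively search over, the first argument.\<close>

datatype recf = Zero | Succ | Proj nat | Comp recf "recf list" | Rec recf recf | Mu recf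

inductive recf_eval :: "recf \<Rightarrow> nat list \<Rightarrow> nat \<Rightarrow> bool" where
  "recf_eval Zero xs 0"
| "recf_eval Succ [x] (Suc x)"
| "i < length xs \<Longrightarrow> recf_eval (Proj i) xs (xs ! i)"
| "list_all2 (\<lambda>g y. recf_eval g xs y) gs ys \<Longrightarrow> recf_eval f ys z \<Longrightarrow> recf_eval (Comp f gs) xs z"
| "recf_eval f xs y \<Longrightarrow> recf_eval (Rec f g) (0 # xs) y"
| "recf_eval (Rec f g) (n # xs) y \<Longrightarrow> recf_eval g (n # y # xs) z \<Longrightarrow>
     recf_eval (Rec f g) (Suc n # xs) z"
| "recf_eval f (n # xs) 0 \<Longrightarrow> (\<forall>m<n. \<exists>k. recf_eval f (m # xs) (Suc k)) \<Longrightarrow>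
     recf_eval (Mu f) xs n"

definition effective_on :: "'a set \<Rightarrow> ('a \<Rightarrow> nat) \<Rightarrow> ('b \<Rightarrow> nat) \<Rightarrow> ('a \<Rightarrow> 'b) \<Rightarrow> bool" where
  "effective_on D code code' T \<longleftrightarrow> (\<exists>r. \<forall>x\<in>D. recf_eval r [code x] (code' (T x)))"

primrec sort_code :: "sort \<Rightarrow> nat" where
  "sort_code (Data n) = 2 * n"
| "sort_code (Codata n) = 2 * n + 1"

primrec trm_code :: "('f \<Rightarrow> nat) \<Rightarrow> 'f trm \<Rightarrow> nat" where
  "trm_code cf (Var s x) = prod_encode (0, prod_encode (sort_code s, x))"
| "trm_code cf (Fn f ts) = prod_encode (1, prod_encode (cf f, list_encode (map (trm_code cf) ts)))"

primrec fm_code :: "('f \<Rightarrow> nat) \<Rightarrow> ('p \<Rightarrow> nat) \<Rightarrow> ('f, 'p) fm \<Rightarrow> nat" where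
  "fm_code cf cp Falsum = prod_encode (0, 0)"
| "fm_code cf cp (Eq t u) = prod_encode (1, prod_encode (trm_code cf t, trm_code cf u))"
| "fm_code cf cp (Pred p ts) =
     prod_encode (2, prod_encode (cp p, list_encode (map (trm_code cf) ts)))"
| "fm_code cf cp (Neg \<phi>) = prod_encode (3, fm_code cf cp \<phi>)"
| "fm_code cf cp (Conj \<phi> \<psi>) = prod_encode (4, prod_encode (fm_code cf cp \<phi>, fm_code cf cp \<psi>))"
| "fm_code cf cp (Disj \<phi> \<psi>) = prod_encode (5, prod_encode (fm_code cf cp \<phi>, fm_code cf cp \<psi>))"
| "fm_code cf cp (Impl \<phi> \<psi>) = prod_encode (6, prod_encode (fm_code cf cp \<phi>, fm_code cf cp \<psi>))"
| "fm_code cf cp (Forall s x \<phi>) =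
     prod_encode (7, prod_encode (prod_encode (sort_code s, x), fm_code cf cp \<phi>))"
| "fm_code cf cp (Exists s x \<phi>) =
     prod_encode (8, prod_encode (prod_encode (sort_code s, x), fm_code cf cp \<phi>))"

primrec cd_fun_code :: "cd_fun \<Rightarrow> nat" where
  "cd_fun_code (Ctor c) = 2 * c"
| "cd_fun_code (Sel c i) = 2 * prod_encode (c, i) + 1"

definition cd_fm_code :: "(cd_fun, unit) fm \<Rightarrow> nat" where
  "cd_fm_code = fm_code cd_fun_code (\<lambda>_. 0)"

text \<open>A generator is the same symbol as the constructor and gets the same code.\<close>

definition tree_fm_code :: "(nat, sort) fm \<Rightarrow> nat" where
  "tree_fm_code = fm_code (\<lambda>c. cd_fun_code (Ctor c)) sort_code"

lemma recf_eval_det: "recf_eval r xs y \<Longrightarrow> recf_eval r xs z \<Longrightarrow> y = z"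
proof (induction arbitrary: z rule: recf_eval.induct)
  case (4 xs gs ys f w)
  from 4(4) obtain ys' where
    ys': "list_all2 (\<lambda>g y. recf_eval g xs y) gs ys'" "recf_eval f ys' z"
    by (cases rule: recf_eval.cases) auto
  have "ys = ys'"
    using 4(1) ys'(1)
    by (auto intro!: nth_equalityI simp: list_all2_conv_all_nth)
  then show ?case using "4.IH" ys'(2) by simp
next
  case (6 f g n xs y w)
  from 6(5) obtain y' where "recf_eval (Rec f g) (n # xs) y'" "recf_eval g (n # y' # xs) z"
    by (cases rule: recf_eval.cases) auto
  then show ?case using 6 by blast
next
  case (7 f n xs)
  from 7(4) have z: "recf_eval f (z # xs) 0" "\<forall>m<z. \<exists>k. recf_eval f (m # xs) (Suc k)"
    by (auto elim: recf_eval.cases)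
  show ?case
  proof (rule linorder_cases[of n z])
    assume "n < z"
    with z(2) obtain k where "recf_eval f (n # xs) (Suc k)" by blast
    with 7(2) show ?thesis by fastforce
  next
    assume "z < n"
    with 7(3) z(1) show ?thesis by fastforce
  qed
next
  case 1 then show ?case by (cases rule: recf_eval.cases) auto
next
  case 2 then show ?case by (cases rule: recf_eval.cases) auto
next
  case 3 from 3(2) show ?case by (cases rule: recf_eval.cases) auto
next
  case (5 f xs y g)
  from 5(3) have "recf_eval f xs z" by (cases rule: recf_eval.cases) auto
  then show ?case by (rule 5(2))
qed

lemma sort_code_inj: "sort_code s = sort_code s' \<longleftrightarrow> s = s'"
  by (cases s; cases s') (auto, presburger+)

lemma trm_code_inj:
  assumes "inj cf"
  shows "trm_code cf t = trm_code cf u \<longleftrightarrow> t = u"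
proof (induction t arbitrary: u)
  case (Var s x)
  then show ?case by (cases u) (auto simp: sort_code_inj)
next
  case (Fn f ts)
  show ?case
  proof (cases u)
    case u: (Fn g us)
    have "map (trm_code cf) ts = map (trm_code cf) us \<Longrightarrow> ts = us"
      using Fn by (metis list.inj_map_strong)
    then show ?thesis
      using u by (auto simp: list_encode_eq inj_eq[OF assms])
  qed auto
qed

lemma fm_code_inj:
  assumes "inj cf" "inj cp"
  shows "inj (fm_code cf cp)"
proof -
  have maps: "map (trm_code cf) ts = map (trm_code cf) us \<longleftrightarrow> ts = us" for ts us
    using trm_code_inj[OF assms(1)] by (metis list.inj_map_strong)
  have "fm_code cf cp \<phi> = fm_code cf cp \<psi> \<Longrightarrow> \<phi> = \<psi>" for \<phi> \<psi>
  proof (induction \<phi> arbitrary: \<psi>)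
    case Falsum then show ?case by (cases \<psi>) auto
  next
    case Eq then show ?case by (cases \<psi>) (auto simp: trm_code_inj[OF assms(1)])
  next
    case Pred then show ?case by (cases \<psi>) (auto simp: maps list_encode_eq inj_eq[OF assms(2)])
  next
    case Neg then show ?case by (cases \<psi>) auto
  next
    case Conj then show ?case by (cases \<psi>) auto
  next
    case Disj then show ?case by (cases \<psi>) auto
  next
    case Impl then show ?case by (cases \<psi>) auto
  next
    case Forall then show ?case by (cases \<psi>) (auto simp: sort_code_inj)
  next
    case Exists then show ?case by (cases \<psi>) (auto simp: sort_code_inj)
  qed
  then show ?thesis by (rule injI)
qed

lemma cd_fm_code_inj: "inj cd_fm_code"
proof -
  have "f = g" if "cd_fun_code f = cd_fun_code g" for f g
    using that by (cases f; cases g) (auto, presburger+)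
  then show ?thesis
    unfolding cd_fm_code_def by (intro fm_code_inj) (auto intro: injI)
qed

lemma tree_fm_code_inj: "inj tree_fm_code"
  unfolding tree_fm_code_def
  by (intro fm_code_inj) (auto intro: injI simp: sort_code_inj)

end

theory Submission
  imports Defs
begin

text \<open>
  Quantifiers over a datatype \<open>s\<close> are relativized to \<open>fin\<^sub>s\<close>, and \<open>fin\<^sub>s(x)\<close> is conjoined for
  every variable \<open>x\<close> of a datatype that occurs in the formula; variables of codatatypes stay
  unconstrained, as codatatypes already contain all trees. Since constructors of datatypes only take
  datatypes as arguments, terms have the same value in a structure of (co)datatypes and in the
  structure of trees. The translation does not look at the signature, because sort symbols record
  whether they are datatypes. On codes it leaves terms unchanged and is otherwise a
  course-of-values recursion, which is reduced to primitive recursion by carrying along the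
  iterated pairing of all earlier values.
\<close>

section \<open>Variables and satisfaction\<close>

primrec vars_trm :: "'f trm \<Rightarrow> (sort \<times> nat) set" where
  "vars_trm (Var s x) = {(s, x)}"
| "vars_trm (Fn f ts) = \<Union> (set (map vars_trm ts))"

primrec vars_fm :: "('f, 'p) fm \<Rightarrow> (sort \<times> nat) set" where
  "vars_fm Falsum = {}"
| "vars_fm (Eq t u) = vars_trm t \<union> vars_trm u"
| "vars_fm (Pred p ts) = \<Union> (set (map vars_trm ts))"
| "vars_fm (Neg \<phi>) = vars_fm \<phi>"
| "vars_fm (Conj \<phi> \<psi>) = vars_fm \<phi> \<union> vars_fm \<psi>"
| "vars_fm (Disj \<phi> \<psi>) = vars_fm \<phi> \<union> vars_fm \<psi>"
| "vars_fm (Impl \<phi> \<psi>) = vars_fm \<phi> \<union> vars_fm \<psi>"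
| "vars_fm (Forall s x \<phi>) = vars_fm \<phi>"
| "vars_fm (Exists s x \<phi>) = vars_fm \<phi>"

lemmas has_sort_Var = has_sort.intros(1)
lemmas has_sort_Fn = has_sort.intros(2)
lemmas has_sort_induct [consumes 1, case_names Var Fn] = has_sort.induct

lemma ground_vars_trm: "ground t \<Longrightarrow> vars_trm t = {}"
  by (induction t) (auto simp: list_all_iff)

lemma has_sort_vars: "has_sort L s t \<Longrightarrow> (r, x) \<in> vars_trm t \<Longrightarrow> r \<in> sorts L"
  by (induction rule: has_sort_induct) (auto simp: list_all2_conv_all_nth in_set_conv_nth)

lemma formula_over_vars: "formula_over L \<phi> \<Longrightarrow> (s, x) \<in> vars_fm \<phi> \<Longrightarrow> s \<in> sorts L"
  by (induction \<phi>)
    (auto dest: has_sort_vars simp: list_all2_conv_all_nth in_set_conv_nth, metis has_sort_vars)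

lemma upd_apply: "upd v s x a r y = (if r = s \<and> y = x then a else v r y)"
  by (simp add: upd_def)

lemma eval_trm_cong:
  "(\<And>s x. (s, x) \<in> vars_trm t \<Longrightarrow> v s x = w s x) \<Longrightarrow> eval_trm A v t = eval_trm A w t"
proof (induction t)
  case (Fn f ts)
  then have "map (eval_trm A v) ts = map (eval_trm A w) ts" by fastforce
  then show ?case by (simp del: map_eq_conv)
qed simp

lemma sat_cong:
  "(\<And>s x. (s, x) \<in> vars_fm \<phi> \<Longrightarrow> v s x = w s x) \<Longrightarrow> sat A v \<phi> \<longleftrightarrow> sat A w \<phi>"
proof (induction \<phi> arbitrary: v w)
  case (Eq t u)
  then have "eval_trm A v t = eval_trm A w t" "eval_trm A v u = eval_trm A w u"
    by (auto intro!: eval_trm_cong)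
  then show ?case by simp
next
  case (Pred p ts)
  then have "map (eval_trm A v) ts = map (eval_trm A w) ts"
    by (fastforce intro: eval_trm_cong)
  then show ?case by (simp del: map_eq_conv)
next
  case (Neg \<phi>)
  from Neg.IH[of v w] Neg.prems show ?case by simp
next
  case (Conj \<phi> \<psi>)
  from Conj.IH[of v w] Conj.prems show ?case by simp
next
  case (Disj \<phi> \<psi>)
  from Disj.IH[of v w] Disj.prems show ?case by simp
next
  case (Impl \<phi> \<psi>)
  from Impl.IH[of v w] Impl.prems show ?case by simp
next
  case (Forall s x \<phi>)
  have "sat A (upd v s x a) \<phi> \<longleftrightarrow> sat A (upd w s x a) \<phi>" for a
    using Forall.prems by (intro Forall.IH) (simp add: upd_apply)
  then show ?case by simp
next
  case (Exists s x \<phi>)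
  have "sat A (upd v s x a) \<phi> \<longleftrightarrow> sat A (upd w s x a) \<phi>" for a
    using Exists.prems by (intro Exists.IH) (simp add: upd_apply)
  then show ?case by simp
qed simp

lemma satisfiable_in_iff_vars:
  assumes universe_nonempty: "\<And>s. s \<in> sorts L \<Longrightarrow> universe A s \<noteq> {}"
    and "formula_over L \<phi>"
  shows "satisfiable_in L A \<phi> \<longleftrightarrow> (\<exists>v. (\<forall>(s, x)\<in>vars_fm \<phi>. v s x \<in> universe A s) \<and> sat A v \<phi>)"
proof
  assume "satisfiable_in L A \<phi>"
  then show "\<exists>v. (\<forall>(s, x)\<in>vars_fm \<phi>. v s x \<in> universe A s) \<and> sat A v \<phi>"
    using formula_over_vars[OF assms(2)] unfolding satisfiable_in_def assignment_into_def by blast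
next
  assume "\<exists>v. (\<forall>(s, x)\<in>vars_fm \<phi>. v s x \<in> universe A s) \<and> sat A v \<phi>"
  then obtain v where v: "\<forall>(s, x)\<in>vars_fm \<phi>. v s x \<in> universe A s" "sat A v \<phi>" by blast
  define w where "w s x = (if v s x \<in> universe A s then v s x else SOME a. a \<in> universe A s)"
    for s x
  have "assignment_into L A w"
    using universe_nonempty by (auto simp: assignment_into_def w_def some_in_eq)
  moreover have "sat A w \<phi>"
    using v sat_cong[of \<phi> v w A] by (fastforce simp: w_def)
  ultimately show "satisfiable_in L A \<phi>" unfolding satisfiable_in_def by blast
qed


section \<open>Selector-free terms and formulas\<close>

inductive ctor_trm :: "ctor_sig \<Rightarrow> sort \<Rightarrow> cd_fun trm \<Rightarrow> bool" for \<Sigma> where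
  Var: "s \<in> csorts \<Sigma> \<Longrightarrow> ctor_trm \<Sigma> s (Var s x)"
| Ctor: "c \<in> ctors \<Sigma> \<Longrightarrow> list_all2 (ctor_trm \<Sigma>) (ctor_args \<Sigma> c) ts \<Longrightarrow>
    ctor_trm \<Sigma> (ctor_res \<Sigma> c) (Fn (Ctor c) ts)"

lemma ctor_trmI:
  assumes "has_sort (cd_language \<Sigma>) s t" "\<And>c i. Sel c i \<notin> funs_trm t"
  shows "ctor_trm \<Sigma> s t"
  using assms
proof (induction rule: has_sort_induct)
  case (Var s x)
  then show ?case by (simp add: cd_language_def ctor_trm.Var)
next
  case (Fn f ts)
  then obtain c where f: "f = Ctor c" by (cases f) auto
  have "list_all2 (ctor_trm \<Sigma>) (ctor_args \<Sigma> c) ts"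
    using Fn.IH Fn.prems f by (auto simp: list_all2_conv_all_nth cd_language_def)
  with Fn.hyps f show ?case
    using ctor_trm.Ctor by (auto simp: cd_language_def)
qed

lemma selector_free_simps [simp]:
  "selector_free (Eq t u) \<longleftrightarrow> (\<forall>c i. Sel c i \<notin> funs_trm t) \<and> (\<forall>c i. Sel c i \<notin> funs_trm u)"
  "selector_free (Neg \<phi>) \<longleftrightarrow> selector_free \<phi>"
  "selector_free (Conj \<phi> \<psi>) \<longleftrightarrow> selector_free \<phi> \<and> selector_free \<psi>"
  "selector_free (Disj \<phi> \<psi>) \<longleftrightarrow> selector_free \<phi> \<and> selector_free \<psi>"
  "selector_free (Impl \<phi> \<psi>) \<longleftrightarrow> selector_free \<phi> \<and> selector_free \<psi>"
  "selector_free (Forall s x \<phi>) \<longleftrightarrow> selector_free \<phi>"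
  "selector_free (Exists s x \<phi>) \<longleftrightarrow> selector_free \<phi>"
  by (auto simp: selector_free_def)

lemma sorts_cd_language [simp]: "sorts (cd_language \<Sigma>) = csorts \<Sigma>"
  and preds_cd_language [simp]: "preds (cd_language \<Sigma>) = {}"
  by (simp_all add: cd_language_def)

lemma tree_language_simps [simp]:
  "sorts (tree_language \<Sigma>) = csorts \<Sigma>"
  "funs (tree_language \<Sigma>) = ctors \<Sigma>"
  "fun_args (tree_language \<Sigma>) = ctor_args \<Sigma>"
  "fun_res (tree_language \<Sigma>) = ctor_res \<Sigma>"
  "preds (tree_language \<Sigma>) = csorts \<Sigma>"
  "pred_args (tree_language \<Sigma>) s = [s]"
  by (simp_all add: tree_language_def)


section \<open>Universes of (co)datatypes\<close>

lemma finite_tree_Node: "finite_tree (Node c ts) \<longleftrightarrow> (\<forall>t\<in>set ts. finite_tree t)"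
proof -
  have "is_node (Node c ts) p \<longleftrightarrow> p = [] \<or> (\<exists>i q. p = i # q \<and> i < length ts \<and> is_node (ts ! i) q)"
    for p
    by (subst is_node.simps) auto
  then have nodes: "{p. is_node (Node c ts) p} =
      insert [] (\<Union>i<length ts. (#) i ` {p. is_node (ts ! i) p})"
    by auto
  have "finite ((#) i ` P) \<longleftrightarrow> finite P" for i :: nat and P
    by (rule finite_image_iff) simp
  then show ?thesis
    unfolding finite_tree_def nodes by (auto simp: all_set_conv_all_nth)
qed

lemma tree_of_sort_Node:
  "tree_of_sort \<Sigma> s (Node c ts) \<longleftrightarrow>
    c \<in> ctors \<Sigma> \<and> s = ctor_res \<Sigma> c \<and> list_all2 (tree_of_sort \<Sigma>) (ctor_args \<Sigma> c) ts"
  by (subst tree_of_sort.simps) auto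

definition cd_universe :: "ctor_sig \<Rightarrow> sort \<Rightarrow> ctree set" where
  "cd_universe \<Sigma> s = {t. tree_of_sort \<Sigma> s t \<and> (is_data s \<longrightarrow> finite_tree t)}"

lemma is_codata_iff: "is_codata s \<longleftrightarrow> \<not> is_data s"
  by (cases s) auto

lemma universe_cd_structure:
  "cd_structure \<Sigma> A \<Longrightarrow> s \<in> csorts \<Sigma> \<Longrightarrow> universe A s = cd_universe \<Sigma> s"
  by (cases s) (auto simp: cd_structure_def cd_universe_def)

lemma ctor_args_subset_csorts:
  "cd_signature \<Sigma> \<Longrightarrow> c \<in> ctors \<Sigma> \<Longrightarrow> set (ctor_args \<Sigma> c) \<subseteq> csorts \<Sigma>"
  unfolding cd_signature_def by blast

lemma is_data_ctor_args:
  "cd_signature \<Sigma> \<Longrightarrow> c \<in> ctors \<Sigma> \<Longrightarrow> s \<in> set (ctor_args \<Sigma> c) \<Longrightarrow>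
    is_data s \<longleftrightarrow> is_data (ctor_res \<Sigma> c)"
  unfolding cd_signature_def is_codata_iff by metis

lemma Node_in_cd_universe:
  assumes "cd_signature \<Sigma>" "c \<in> ctors \<Sigma>"
  shows "Node c ts \<in> cd_universe \<Sigma> (ctor_res \<Sigma> c) \<longleftrightarrow>
    list_all2 (\<lambda>s t. t \<in> cd_universe \<Sigma> s) (ctor_args \<Sigma> c) ts"
proof -
  have "list_all2 (\<lambda>s t. t \<in> cd_universe \<Sigma> s) (ctor_args \<Sigma> c) ts \<longleftrightarrow>
      list_all2 (tree_of_sort \<Sigma>) (ctor_args \<Sigma> c) ts \<and>
      (is_data (ctor_res \<Sigma> c) \<longrightarrow> (\<forall>t\<in>set ts. finite_tree t))"
    using is_data_ctor_args[OF assms]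
    by (auto simp: cd_universe_def list_all2_conv_all_nth all_set_conv_all_nth)
  then show ?thesis
    using assms(2) by (auto simp: cd_universe_def tree_of_sort_Node finite_tree_Node)
qed

lemma fun_interp_Ctor:
  assumes "cd_signature \<Sigma>" "cd_structure \<Sigma> A" "c \<in> ctors \<Sigma>"
    and "list_all2 (\<lambda>s t. t \<in> cd_universe \<Sigma> s) (ctor_args \<Sigma> c) ts"
  shows "fun_interp A (Ctor c) ts = Node c ts"
proof -
  have "list_all2 (\<lambda>s t. t \<in> universe A s) (ctor_args \<Sigma> c) ts"
    using assms(4) ctor_args_subset_csorts[OF assms(1,3)] universe_cd_structure[OF assms(2)]
    by (auto elim!: list.rel_mono_strong)
  then show ?thesis using assms(2,3) unfolding cd_structure_def by blast
qed

definition some_ctor :: "ctor_sig \<Rightarrow> sort \<Rightarrow> nat" where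
  "some_ctor \<Sigma> s = (SOME c. c \<in> ctors \<Sigma> \<and> ctor_res \<Sigma> c = s)"

primcorec some_tree :: "ctor_sig \<Rightarrow> sort \<Rightarrow> ctree" where
  "some_tree \<Sigma> s = Node (some_ctor \<Sigma> s) (map (some_tree \<Sigma>) (ctor_args \<Sigma> (some_ctor \<Sigma> s)))"

lemma some_ctor:
  assumes "cd_signature \<Sigma>" "s \<in> csorts \<Sigma>"
  shows "some_ctor \<Sigma> s \<in> ctors \<Sigma>" "ctor_res \<Sigma> (some_ctor \<Sigma> s) = s"
proof -
  have "\<exists>c. c \<in> ctors \<Sigma> \<and> ctor_res \<Sigma> c = s"
    using assms unfolding cd_signature_def by blast
  from someI_ex[OF this]
  show "some_ctor \<Sigma> s \<in> ctors \<Sigma>" "ctor_res \<Sigma> (some_ctor \<Sigma> s) = s"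
    by (simp_all add: some_ctor_def)
qed

lemma tree_of_sort_some_tree:
  assumes "cd_signature \<Sigma>" "s \<in> csorts \<Sigma>"
  shows "tree_of_sort \<Sigma> s (some_tree \<Sigma> s)"
  using assms(2)
proof (coinduction arbitrary: s)
  case tree_of_sort
  have "set (ctor_args \<Sigma> (some_ctor \<Sigma> s)) \<subseteq> csorts \<Sigma>"
    using ctor_args_subset_csorts[OF assms(1)] some_ctor(1)[OF assms(1) tree_of_sort] by simp
  then show ?case
    using some_ctor[OF assms(1) tree_of_sort] some_tree.code[of \<Sigma> s]
    by (auto simp: list_all2_conv_all_nth)
qed


section \<open>The translation\<close>

abbreviation Verum :: "('f, 'p) fm" where
  "Verum \<equiv> Neg Falsum"

primrec Conjs :: "('f, 'p) fm list \<Rightarrow> ('f, 'p) fm" where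
  "Conjs [] = Verum"
| "Conjs (\<phi> # \<phi>s) = Conj \<phi> (Conjs \<phi>s)"

lemma sat_Conjs: "sat A v (Conjs \<phi>s) \<longleftrightarrow> (\<forall>\<phi>\<in>set \<phi>s. sat A v \<phi>)"
  by (induction \<phi>s) auto

lemma formula_over_Conjs: "formula_over L (Conjs \<phi>s) \<longleftrightarrow> (\<forall>\<phi>\<in>set \<phi>s. formula_over L \<phi>)"
  by (induction \<phi>s) auto

definition fin_guard :: "sort \<Rightarrow> nat \<Rightarrow> (nat, sort) fm" where
  "fin_guard s x = (if is_data s then Pred s [Var s x] else Verum)"

primrec fin_trm :: "'f trm \<Rightarrow> (nat, sort) fm" where
  "fin_trm (Var s x) = fin_guard s x"
| "fin_trm (Fn f ts) = Conjs (map fin_trm ts)"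

text \<open>Bound variables are constrained too. This is harmless: the value that an assignment gives to
  such a variable does not matter, and every datatype has a finite tree.\<close>

primrec fin_fm :: "('f, 'p) fm \<Rightarrow> (nat, sort) fm" where
  "fin_fm Falsum = Verum"
| "fin_fm (Eq t u) = Conj (fin_trm t) (fin_trm u)"
| "fin_fm (Pred p ts) = Conjs (map fin_trm ts)"
| "fin_fm (Neg \<phi>) = fin_fm \<phi>"
| "fin_fm (Conj \<phi> \<psi>) = Conj (fin_fm \<phi>) (fin_fm \<psi>)"
| "fin_fm (Disj \<phi> \<psi>) = Conj (fin_fm \<phi>) (fin_fm \<psi>)"
| "fin_fm (Impl \<phi> \<psi>) = Conj (fin_fm \<phi>) (fin_fm \<psi>)"
| "fin_fm (Forall s x \<phi>) = fin_fm \<phi>"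
| "fin_fm (Exists s x \<phi>) = fin_fm \<phi>"

text \<open>The values at selectors and at predicate symbols are junk: the formulas to be translated have
  neither.\<close>

primrec ctor_of :: "cd_fun \<Rightarrow> nat" where
  "ctor_of (Ctor c) = c"
| "ctor_of (Sel c i) = c"

abbreviation tree_trm :: "cd_fun trm \<Rightarrow> nat trm" where
  "tree_trm \<equiv> map_trm ctor_of"

primrec relativize :: "(cd_fun, 'p) fm \<Rightarrow> (nat, sort) fm" where
  "relativize Falsum = Falsum"
| "relativize (Eq t u) = Eq (tree_trm t) (tree_trm u)"
| "relativize (Pred p ts) = Falsum"
| "relativize (Neg \<phi>) = Neg (relativize \<phi>)"
| "relativize (Conj \<phi> \<psi>) = Conj (relativize \<phi>) (relativize \<psi>)"
| "relativize (Disj \<phi> \<psi>) = Disj (relativize \<phi>) (relativize \<psi>)"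
| "relativize (Impl \<phi> \<psi>) = Impl (relativize \<phi>) (relativize \<psi>)"
| "relativize (Forall s x \<phi>) = Forall s x (Impl (fin_guard s x) (relativize \<phi>))"
| "relativize (Exists s x \<phi>) = Exists s x (Conj (fin_guard s x) (relativize \<phi>))"

definition to_tree_fm :: "(cd_fun, 'p) fm \<Rightarrow> (nat, sort) fm" where
  "to_tree_fm \<phi> = Conj (relativize \<phi>) (fin_fm \<phi>)"

lemma has_sort_tree_trm: "ctor_trm \<Sigma> s t \<Longrightarrow> has_sort (tree_language \<Sigma>) s (tree_trm t)"
proof (induction rule: ctor_trm.induct)
  case (Var s x)
  then show ?case by (simp add: has_sort_Var)
next
  case (Ctor c ts)
  then have "list_all2 (has_sort (tree_language \<Sigma>)) (ctor_args \<Sigma> c) (map tree_trm ts)"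
    by (auto simp: list.rel_map elim: list.rel_mono_strong)
  with Ctor.hyps has_sort_Fn[of c "tree_language \<Sigma>"] show ?case by simp
qed

lemma formula_over_fin_guard: "s \<in> csorts \<Sigma> \<Longrightarrow> formula_over (tree_language \<Sigma>) (fin_guard s x)"
  by (simp add: fin_guard_def has_sort_Var)

lemma formula_over_fin_trm:
  "(\<And>s x. (s, x) \<in> vars_trm t \<Longrightarrow> s \<in> csorts \<Sigma>) \<Longrightarrow> formula_over (tree_language \<Sigma>) (fin_trm t)"
  by (induction t) (auto simp: formula_over_Conjs formula_over_fin_guard)

lemma formula_over_fin_fm:
  "(\<And>s x. (s, x) \<in> vars_fm \<phi> \<Longrightarrow> s \<in> csorts \<Sigma>) \<Longrightarrow> formula_over (tree_language \<Sigma>) (fin_fm \<phi>)"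
  by (induction \<phi>) (auto simp: formula_over_Conjs intro: formula_over_fin_trm)

lemma formula_over_relativize:
  "formula_over (cd_language \<Sigma>) \<phi> \<Longrightarrow> selector_free \<phi> \<Longrightarrow>
    formula_over (tree_language \<Sigma>) (relativize \<phi>)"
proof (induction \<phi>)
  case (Eq t u)
  then show ?case by (auto intro!: has_sort_tree_trm ctor_trmI)
qed (simp_all add: formula_over_fin_guard)

lemma formula_over_to_tree_fm:
  assumes "formula_over (cd_language \<Sigma>) \<phi>" "selector_free \<phi>"
  shows "formula_over (tree_language \<Sigma>) (to_tree_fm \<phi>)"
  using formula_over_relativize[OF assms] formula_over_vars[OF assms(1)]
  by (auto simp: to_tree_fm_def intro!: formula_over_fin_fm)


section \<open>Equisatisfiability\<close>

lemma universe_tree_structure [simp]: "universe (tree_structure \<Sigma>) s = {t. tree_of_sort \<Sigma> s t}"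
  by (simp add: tree_structure_def)

lemma eval_tree_trm_in_cd_universe:
  assumes "cd_signature \<Sigma>" "ctor_trm \<Sigma> s t"
    and "\<forall>(r, x)\<in>vars_trm t. v r x \<in> cd_universe \<Sigma> r"
  shows "eval_trm (tree_structure \<Sigma>) v (tree_trm t) \<in> cd_universe \<Sigma> s"
  using assms(2,3)
proof (induction rule: ctor_trm.induct)
  case (Ctor c ts)
  then have "list_all2 (\<lambda>s t. t \<in> cd_universe \<Sigma> s) (ctor_args \<Sigma> c)
      (map (eval_trm (tree_structure \<Sigma>) v) (map tree_trm ts))"
    by (auto simp: list.rel_map elim!: list.rel_mono_strong)
  with Node_in_cd_universe[OF assms(1) Ctor.hyps] show ?case
    by (simp add: tree_structure_def)
qed simp

lemma eval_tree_trm: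
  assumes "cd_signature \<Sigma>" "cd_structure \<Sigma> A" "ctor_trm \<Sigma> s t"
    and "\<forall>(r, x)\<in>vars_trm t. v r x \<in> cd_universe \<Sigma> r"
  shows "eval_trm (tree_structure \<Sigma>) v (tree_trm t) = eval_trm A v t"
  using assms(3,4)
proof (induction rule: ctor_trm.induct)
  case (Ctor c ts)
  let ?us = "map (eval_trm (tree_structure \<Sigma>) v) (map tree_trm ts)"
  have "list_all2 (\<lambda>s t. t \<in> cd_universe \<Sigma> s) (ctor_args \<Sigma> c) ?us"
    using Ctor eval_tree_trm_in_cd_universe[OF assms(1)]
    by (fastforce simp: list.rel_map elim!: list.rel_mono_strong)
  then have "fun_interp A (Ctor c) ?us = Node c ?us"
    by (rule fun_interp_Ctor[OF assms(1,2) Ctor.hyps])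
  moreover have "?us = map (eval_trm A v) ts"
    using Ctor by (fastforce simp: list_all2_conv_all_nth in_set_conv_nth)
  ultimately show ?case
    by (simp add: tree_structure_def del: map_map map_eq_conv)
qed simp

lemma cd_universe_nonempty:
  assumes "cd_signature \<Sigma>" "s \<in> csorts \<Sigma>"
  shows "cd_universe \<Sigma> s \<noteq> {}"
proof (cases "is_data s")
  case True
  then obtain t where "ground_ctor_term \<Sigma> s t"
    using assms unfolding cd_signature_def by blast
  then have "ctor_trm \<Sigma> s t" "vars_trm t = {}"
    by (auto simp: ground_ctor_term_def ground_vars_trm intro!: ctor_trmI)
  then have "eval_trm (tree_structure \<Sigma>) undefined (tree_trm t) \<in> cd_universe \<Sigma> s"
    by (intro eval_tree_trm_in_cd_universe[OF assms(1)]) auto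
  then show ?thesis by blast
next
  case False
  then have "some_tree \<Sigma> s \<in> cd_universe \<Sigma> s"
    using tree_of_sort_some_tree[OF assms] by (simp add: cd_universe_def)
  then show ?thesis by blast
qed

lemma cd_structure_exists:
  assumes "cd_signature \<Sigma>"
  shows "\<exists>A. cd_structure \<Sigma> A"
proof -
  define sel where "sel c i t = (if root t = c then children t ! i
    else SOME u. u \<in> cd_universe \<Sigma> (ctor_args \<Sigma> c ! i))" for c i t
  define A :: "(cd_fun, unit, ctree) struct" where
    "A = \<lparr>universe = cd_universe \<Sigma>,
          fun_interp = (\<lambda>f ts. case f of Ctor c \<Rightarrow> Node c ts | Sel c i \<Rightarrow> sel c i (hd ts)),
          pred_interp = (\<lambda>_ _. False)\<rparr>"
  have "sel c i t \<in> cd_universe \<Sigma> (ctor_args \<Sigma> c ! i)"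
    if "c \<in> ctors \<Sigma>" "i < length (ctor_args \<Sigma> c)" "t \<in> cd_universe \<Sigma> (ctor_res \<Sigma> c)" for c i t
  proof (cases "root t = c")
    case True
    then show ?thesis
      using Node_in_cd_universe[OF assms that(1), of "children t"] that
      by (cases t) (auto simp: sel_def list_all2_conv_all_nth)
  next
    case False
    have "ctor_args \<Sigma> c ! i \<in> csorts \<Sigma>"
      using ctor_args_subset_csorts[OF assms that(1)] that(2) by auto
    with False show ?thesis
      using cd_universe_nonempty[OF assms] by (simp add: sel_def some_in_eq)
  qed
  moreover have "root t = c \<Longrightarrow> sel c i t = children t ! i" for c i t
    by (simp add: sel_def)
  moreover have "is_codata s \<Longrightarrow> cd_universe \<Sigma> s = {t. tree_of_sort \<Sigma> s t}"
    "is_data s \<Longrightarrow> cd_universe \<Sigma> s = {t. tree_of_sort \<Sigma> s t \<and> finite_tree t}" for s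
    by (simp_all add: cd_universe_def is_codata_iff)
  ultimately have "cd_structure \<Sigma> A"
    by (simp add: cd_structure_def A_def)
  then show ?thesis by blast
qed

lemma sat_fin_guard:
  "tree_of_sort \<Sigma> s (v s x) \<Longrightarrow>
    sat (tree_structure \<Sigma>) v (fin_guard s x) \<longleftrightarrow> v s x \<in> cd_universe \<Sigma> s"
  by (simp add: fin_guard_def tree_structure_def cd_universe_def)

lemma sat_fin_trm:
  "\<forall>(s, x)\<in>vars_trm t. tree_of_sort \<Sigma> s (v s x) \<Longrightarrow>
    sat (tree_structure \<Sigma>) v (fin_trm t) \<longleftrightarrow> (\<forall>(s, x)\<in>vars_trm t. v s x \<in> cd_universe \<Sigma> s)"
  by (induction t) (auto simp: sat_Conjs sat_fin_guard)

lemma sat_fin_fm: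
  "\<forall>(s, x)\<in>vars_fm \<phi>. tree_of_sort \<Sigma> s (v s x) \<Longrightarrow>
    sat (tree_structure \<Sigma>) v (fin_fm \<phi>) \<longleftrightarrow> (\<forall>(s, x)\<in>vars_fm \<phi>. v s x \<in> cd_universe \<Sigma> s)"
  by (induction \<phi>) (auto simp: sat_Conjs sat_fin_trm)

lemma sat_relativize:
  assumes "cd_signature \<Sigma>" "cd_structure \<Sigma> A"
    and "formula_over (cd_language \<Sigma>) \<phi>" "selector_free \<phi>"
    and "\<forall>(s, x)\<in>vars_fm \<phi>. v s x \<in> cd_universe \<Sigma> s"
  shows "sat (tree_structure \<Sigma>) v (relativize \<phi>) \<longleftrightarrow> sat A v \<phi>"
  using assms(3-)
proof (induction \<phi> arbitrary: v)
  case (Eq t u)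
  then have "eval_trm (tree_structure \<Sigma>) v (tree_trm t) = eval_trm A v t"
    "eval_trm (tree_structure \<Sigma>) v (tree_trm u) = eval_trm A v u"
    by (auto intro!: eval_tree_trm[OF assms(1,2)] ctor_trmI)
  then show ?case by simp
next
  case (Forall s x \<phi>)
  have "sat (tree_structure \<Sigma>) (upd v s x a) (relativize \<phi>) \<longleftrightarrow> sat A (upd v s x a) \<phi>"
    if "a \<in> cd_universe \<Sigma> s" for a
    using Forall.prems that by (intro Forall.IH) (auto simp: upd_apply)
  then show ?case
    using universe_cd_structure[OF assms(2)] Forall.prems
    by (auto simp: sat_fin_guard upd_apply) (auto simp: cd_universe_def)
next
  case (Exists s x \<phi>)
  have "sat (tree_structure \<Sigma>) (upd v s x a) (relativize \<phi>) \<longleftrightarrow> sat A (upd v s x a) \<phi>"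
    if "a \<in> cd_universe \<Sigma> s" for a
    using Exists.prems that by (intro Exists.IH) (auto simp: upd_apply)
  then show ?case
    using universe_cd_structure[OF assms(2)] Exists.prems
    by (auto simp: sat_fin_guard upd_apply) (auto simp: cd_universe_def)
qed auto

lemma tree_satisfiable_if_cd_satisfiable:
  assumes \<Sigma>: "cd_signature \<Sigma>" and \<phi>: "formula_over (cd_language \<Sigma>) \<phi>" "selector_free \<phi>"
    and "cd_satisfiable \<Sigma> \<phi>"
  shows "tree_satisfiable \<Sigma> (to_tree_fm \<phi>)"
proof -
  obtain A v where A: "cd_structure \<Sigma> A" and v: "assignment_into (cd_language \<Sigma>) A v"
    and "sat A v \<phi>"
    using assms(4) unfolding cd_satisfiable_def satisfiable_in_def by blast
  have v_in: "v s x \<in> cd_universe \<Sigma> s" if "s \<in> csorts \<Sigma>" for s x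
    using v universe_cd_structure[OF A that] that by (auto simp: assignment_into_def)
  then have "\<forall>(s, x)\<in>vars_fm \<phi>. v s x \<in> cd_universe \<Sigma> s"
    using formula_over_vars[OF \<phi>(1)] by auto
  moreover from this have "\<forall>(s, x)\<in>vars_fm \<phi>. tree_of_sort \<Sigma> s (v s x)"
    by (auto simp: cd_universe_def)
  ultimately have "sat (tree_structure \<Sigma>) v (to_tree_fm \<phi>)"
    using \<open>sat A v \<phi>\<close> by (simp add: to_tree_fm_def sat_relativize[OF \<Sigma> A \<phi>] sat_fin_fm)
  then show ?thesis
    using v_in
    by (auto simp: tree_satisfiable_def satisfiable_in_def assignment_into_def cd_universe_def)
qed

lemma cd_satisfiable_if_tree_satisfiable:
  assumes \<Sigma>: "cd_signature \<Sigma>" and \<phi>: "formula_over (cd_language \<Sigma>) \<phi>" "selector_free \<phi>"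
    and "tree_satisfiable \<Sigma> (to_tree_fm \<phi>)"
  shows "cd_satisfiable \<Sigma> \<phi>"
proof -
  obtain v where "\<forall>s\<in>csorts \<Sigma>. \<forall>x. tree_of_sort \<Sigma> s (v s x)"
    and sat: "sat (tree_structure \<Sigma>) v (relativize \<phi>)" "sat (tree_structure \<Sigma>) v (fin_fm \<phi>)"
    using assms(4)
    by (auto simp: tree_satisfiable_def satisfiable_in_def to_tree_fm_def assignment_into_def)
  then have "\<forall>(s, x)\<in>vars_fm \<phi>. tree_of_sort \<Sigma> s (v s x)"
    using formula_over_vars[OF \<phi>(1)] by auto
  then have v_in: "\<forall>(s, x)\<in>vars_fm \<phi>. v s x \<in> cd_universe \<Sigma> s"
    using sat(2) by (simp add: sat_fin_fm)
  obtain A where A: "cd_structure \<Sigma> A" using cd_structure_exists[OF \<Sigma>] by blast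
  have "sat A v \<phi>"
    using sat(1) sat_relativize[OF \<Sigma> A \<phi> v_in] by simp
  moreover have "\<forall>(s, x)\<in>vars_fm \<phi>. v s x \<in> universe A s"
    using v_in formula_over_vars[OF \<phi>(1)] universe_cd_structure[OF A] by fastforce
  ultimately have "satisfiable_in (cd_language \<Sigma>) A \<phi>"
    using cd_universe_nonempty[OF \<Sigma>] universe_cd_structure[OF A]
    by (subst satisfiable_in_iff_vars[OF _ \<phi>(1)]) auto
  with A show ?thesis unfolding cd_satisfiable_def by blast
qed


section \<open>Total recursive functions\<close>

lemmas recf_eval_Zero = recf_eval.intros(1)
lemmas recf_eval_Succ = recf_eval.intros(2)
lemmas recf_eval_Proj = recf_eval.intros(3)
lemmas recf_eval_Comp = recf_eval.intros(4)
lemmas recf_eval_Rec_0 = recf_eval.intros(5)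
lemmas recf_eval_Rec_Suc = recf_eval.intros(6)

definition total_recursive :: "nat \<Rightarrow> (nat list \<Rightarrow> nat) \<Rightarrow> bool" where
  "total_recursive k f \<longleftrightarrow> (\<exists>r. \<forall>xs. length xs = k \<longrightarrow> recf_eval r xs (f xs))"

named_theorems total_recursive_intros

lemma total_recursive_nth [total_recursive_intros]: "i < k \<Longrightarrow> total_recursive k (\<lambda>xs. xs ! i)"
  unfolding total_recursive_def by (metis recf_eval_Proj)

lemma total_recursive_comp:
  assumes "total_recursive (length gs) f" "\<forall>g\<in>set gs. total_recursive k g"
  shows "total_recursive k (\<lambda>xs. f (map (\<lambda>g. g xs) gs))"
proof -
  obtain rf where rf: "\<And>ys. length ys = length gs \<Longrightarrow> recf_eval rf ys (f ys)"
    using assms(1) unfolding total_recursive_def by blast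
  obtain r where r: "\<And>g xs. g \<in> set gs \<Longrightarrow> length xs = k \<Longrightarrow> recf_eval (r g) xs (g xs)"
    using assms(2) unfolding total_recursive_def by metis
  have "recf_eval (Comp rf (map r gs)) xs (f (map (\<lambda>g. g xs) gs))" if "length xs = k" for xs
    using r[OF _ that]
    by (auto intro!: recf_eval_Comp rf simp: list.rel_map list.rel_refl_strong)
  then show ?thesis unfolding total_recursive_def by blast
qed

lemma total_recursive_zero: "total_recursive k (\<lambda>_. 0)"
  unfolding total_recursive_def by (blast intro: recf_eval_Zero)

lemma total_recursive_Suc [total_recursive_intros]:
  assumes "total_recursive k a"
  shows "total_recursive k (\<lambda>xs. Suc (a xs))"
proof -
  have "recf_eval Succ ys (Suc (ys ! 0))" if "length ys = 1" for ys
    using that by (cases ys) (auto intro: recf_eval_Succ)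
  then have "total_recursive 1 (\<lambda>ys. Suc (ys ! 0))"
    unfolding total_recursive_def by blast
  with assms show ?thesis
    using total_recursive_comp[of "[a]" "\<lambda>ys. Suc (ys ! 0)" k] by simp
qed

lemma total_recursive_const [total_recursive_intros]: "total_recursive k (\<lambda>_. n)"
  by (induction n) (rule total_recursive_zero, rule total_recursive_Suc)

lemma total_recursive_drop [total_recursive_intros]:
  assumes "total_recursive k a"
  shows "total_recursive (n + k) (\<lambda>xs. a (drop n xs))"
proof -
  have "map (\<lambda>i. xs ! (n + i)) [0..<k] = drop n xs" if "length xs = n + k" for xs :: "nat list"
    using that by (auto intro: nth_equalityI)
  moreover have "total_recursive (n + k) (\<lambda>xs. a (map (\<lambda>i. xs ! (n + i)) [0..<k]))"
    using total_recursive_comp[of "map (\<lambda>i xs. xs ! (n + i)) [0..<k]" a "n + k"] assms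
    by (auto simp: total_recursive_nth comp_def)
  ultimately show ?thesis unfolding total_recursive_def by metis
qed

lemma total_recursive_rec_nat [total_recursive_intros]:
  assumes "total_recursive k c" "total_recursive k b"
    and "total_recursive (2 + k) (\<lambda>ys. s (ys ! 0) (ys ! 1) (drop 2 ys))"
  shows "total_recursive k (\<lambda>xs. rec_nat (b xs) (\<lambda>n y. s n y xs) (c xs))"
proof -
  let ?rec = "\<lambda>xs. rec_nat (b xs) (\<lambda>n y. s n y xs)"
  obtain rb where rb: "\<And>xs. length xs = k \<Longrightarrow> recf_eval rb xs (b xs)"
    using assms(2) unfolding total_recursive_def by blast
  obtain rs where rs: "\<And>ys. length ys = 2 + k \<Longrightarrow>
      recf_eval rs ys (s (ys ! 0) (ys ! 1) (drop 2 ys))"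
    using assms(3) unfolding total_recursive_def by blast
  have "recf_eval (Rec rb rs) (n # xs) (?rec xs n)" if "length xs = k" for n xs
  proof (induction n)
    case 0
    show ?case using rb[OF that] by (auto intro: recf_eval_Rec_0)
  next
    case (Suc n)
    show ?case using recf_eval_Rec_Suc[OF Suc] rs[of "n # ?rec xs n # xs"] that by auto
  qed
  then have "recf_eval (Rec rb rs) ys (?rec (tl ys) (hd ys))" if "length ys = Suc k" for ys
    using that by (cases ys) auto
  then have "total_recursive (Suc k) (\<lambda>ys. ?rec (tl ys) (hd ys))"
    unfolding total_recursive_def by blast
  then have "total_recursive k (\<lambda>xs. ?rec (map ((!) xs) [0..<k]) (c xs))"
    using total_recursive_comp[of "c # map (\<lambda>i xs. xs ! i) [0..<k]" "\<lambda>ys. ?rec (tl ys) (hd ys)" k]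
      assms(1)
    by (auto simp: total_recursive_nth comp_def)
  moreover have "map ((!) xs) [0..<k] = xs" if "length xs = k" for xs :: "nat list"
    using that map_nth by blast
  ultimately show ?thesis unfolding total_recursive_def by metis
qed

lemma total_recursive_case_nat [total_recursive_intros]:
  assumes "total_recursive k c" "total_recursive k b"
    and "total_recursive (2 + k) (\<lambda>ys. s (ys ! 0) (drop 2 ys))"
  shows "total_recursive k (\<lambda>xs. case c xs of 0 \<Rightarrow> b xs | Suc n \<Rightarrow> s n xs)"
proof -
  have case_eq_rec: "(case n of 0 \<Rightarrow> z | Suc m \<Rightarrow> f m) = rec_nat z (\<lambda>m _. f m) n"
    for n z :: nat and f
    by (cases n) auto
  show ?thesis unfolding case_eq_rec by (intro total_recursive_intros assms)
qed

lemma total_recursive_add [total_recursive_intros]: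
  assumes "total_recursive k a" "total_recursive k b"
  shows "total_recursive k (\<lambda>xs. a xs + b xs)"
proof -
  have add_eq_rec: "m + n = rec_nat m (\<lambda>_. Suc) n" for m n
    by (induction n) auto
  show ?thesis unfolding add_eq_rec by (intro total_recursive_intros assms) simp
qed

lemma total_recursive_diff [total_recursive_intros]:
  assumes "total_recursive k a" "total_recursive k b"
  shows "total_recursive k (\<lambda>xs. a xs - b xs)"
proof -
  have diff_eq_rec: "m - n = rec_nat m (\<lambda>_ y. case y of 0 \<Rightarrow> 0 | Suc z \<Rightarrow> z) n" for m n
    by (induction n) (auto split: nat.split)
  show ?thesis unfolding diff_eq_rec by (intro total_recursive_intros assms) simp_all
qed

lemma total_recursive_of_bool_le [total_recursive_intros]:
  assumes "total_recursive k a" "total_recursive k b"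
  shows "total_recursive k (\<lambda>xs. of_bool (a xs \<le> b xs))"
proof -
  have le_eq_diff: "of_bool (m \<le> n) = 1 - (m - n)" for m n :: nat by simp
  show ?thesis unfolding le_eq_diff by (intro total_recursive_intros assms)
qed

lemma total_recursive_of_bool_eq [total_recursive_intros]:
  assumes "total_recursive k a" "total_recursive k b"
  shows "total_recursive k (\<lambda>xs. of_bool (a xs = b xs))"
proof -
  have eq_eq_diff: "of_bool (m = n) = 1 - ((m - n) + (n - m))" for m n :: nat by auto
  show ?thesis unfolding eq_eq_diff by (intro total_recursive_intros assms)
qed

lemma total_recursive_of_bool_even [total_recursive_intros]:
  assumes "total_recursive k a"
  shows "total_recursive k (\<lambda>xs. of_bool (even (a xs)))"
proof -
  have even_eq_rec: "of_bool (even n) = rec_nat 1 (\<lambda>_ y :: nat. 1 - y) n" for n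
    by (induction n) (auto simp: of_bool_def)
  show ?thesis unfolding even_eq_rec by (intro total_recursive_intros assms) simp
qed

lemma total_recursive_if [total_recursive_intros]:
  assumes "total_recursive k (\<lambda>xs. of_bool (P xs))" "total_recursive k a" "total_recursive k b"
  shows "total_recursive k (\<lambda>xs. if P xs then a xs else b xs)"
proof -
  have if_eq_case: "(if Q then m else n) = (case of_bool Q of 0 \<Rightarrow> n | Suc _ \<Rightarrow> m)"
    for Q and m n :: nat
    by simp
  show ?thesis unfolding if_eq_case by (intro total_recursive_intros assms)
qed

lemma total_recursive_of_bool_disj [total_recursive_intros]:
  assumes "total_recursive k (\<lambda>xs. of_bool (P xs))" "total_recursive k (\<lambda>xs. of_bool (Q xs))"
  shows "total_recursive k (\<lambda>xs. of_bool (P xs \<or> Q xs))"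
proof -
  have disj_eq_if: "of_bool (R \<or> S) = (if R then 1 else of_bool S :: nat)" for R S by simp
  show ?thesis unfolding disj_eq_if by (intro total_recursive_intros assms)
qed

lemma total_recursive_triangle [total_recursive_intros]:
  assumes "total_recursive k a"
  shows "total_recursive k (\<lambda>xs. triangle (a xs))"
proof -
  have triangle_eq_rec: "triangle n = rec_nat 0 (\<lambda>m y. y + Suc m) n" for n
    by (induction n) auto
  show ?thesis unfolding triangle_eq_rec by (intro total_recursive_intros assms) simp_all
qed

lemma total_recursive_prod_encode [total_recursive_intros]:
  "total_recursive k a \<Longrightarrow> total_recursive k b \<Longrightarrow>
    total_recursive k (\<lambda>xs. prod_encode (a xs, b xs))"
  by (simp add: prod_encode_def total_recursive_intros)

text \<open>The library decodes pairs by a recursion that is not primitive. The index of the diagonal of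
  a pair grows by one exactly at the triangular numbers, and it determines both components.\<close>

primrec diagonal :: "nat \<Rightarrow> nat" where
  "diagonal 0 = 0"
| "diagonal (Suc n) =
    (if triangle (Suc (diagonal n)) \<le> Suc n then Suc (diagonal n) else diagonal n)"

lemma diagonal_bounds: "triangle (diagonal n) \<le> n \<and> n < triangle (Suc (diagonal n))"
  by (induction n) auto

lemma diagonal_prod_encode: "diagonal (prod_encode (a, b)) = a + b"
proof -
  let ?d = "diagonal (prod_encode (a, b))"
  have "mono triangle" by (intro mono_iff_le_Suc[THEN iffD2]) simp
  moreover have "triangle (a + b) \<le> prod_encode (a, b)"
    "prod_encode (a, b) < triangle (Suc (a + b))"
    by (auto simp: prod_encode_def)
  with diagonal_bounds[of "prod_encode (a, b)"]
  have "triangle ?d < triangle (Suc (a + b))" "triangle (a + b) < triangle (Suc ?d)"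
    by linarith+
  ultimately show ?thesis by (metis antisym less_Suc_eq_le mono_strict_invE)
qed

lemma total_recursive_diagonal [total_recursive_intros]:
  assumes "total_recursive k a"
  shows "total_recursive k (\<lambda>xs. diagonal (a xs))"
proof -
  have diagonal_eq_rec:
    "diagonal n = rec_nat 0 (\<lambda>m y. if triangle (Suc y) \<le> Suc m then Suc y else y) n" for n
    by (induction n) auto
  show ?thesis unfolding diagonal_eq_rec by (intro total_recursive_intros assms) simp_all
qed

definition pfst :: "nat \<Rightarrow> nat" where
  "pfst n = fst (prod_decode n)"

definition psnd :: "nat \<Rightarrow> nat" where
  "psnd n = snd (prod_decode n)"

lemma pfst_prod_encode [simp]: "pfst (prod_encode (a, b)) = a"
  and psnd_prod_encode [simp]: "psnd (prod_encode (a, b)) = b"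
  by (simp_all add: pfst_def psnd_def)

lemma prod_encode_cases: obtains a b where "n = prod_encode (a, b)"
  by (metis prod_decode_inverse surj_pair)

lemma pfst_eq: "pfst n = n - triangle (diagonal n)"
  by (cases n rule: prod_encode_cases) (simp add: diagonal_prod_encode, simp add: prod_encode_def)

lemma psnd_eq: "psnd n = diagonal n - pfst n"
  by (cases n rule: prod_encode_cases) (simp add: diagonal_prod_encode)

lemma total_recursive_pfst [total_recursive_intros]:
  "total_recursive k a \<Longrightarrow> total_recursive k (\<lambda>xs. pfst (a xs))"
  unfolding pfst_eq by (intro total_recursive_intros)

lemma total_recursive_psnd [total_recursive_intros]:
  "total_recursive k a \<Longrightarrow> total_recursive k (\<lambda>xs. psnd (a xs))"
  unfolding psnd_eq by (intro total_recursive_intros)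


section \<open>Course-of-values recursion\<close>

text \<open>The history of a function at \<open>n\<close> pairs up its values at \<open>n - 1, \<dots>, 0\<close>.\<close>

definition lookup :: "nat \<Rightarrow> nat \<Rightarrow> nat \<Rightarrow> nat" where
  "lookup n h m = pfst (rec_nat h (\<lambda>_. psnd) (n - Suc m))"

primrec history :: "(nat \<Rightarrow> (nat \<Rightarrow> nat) \<Rightarrow> nat) \<Rightarrow> nat \<Rightarrow> nat" where
  "history g 0 = 0"
| "history g (Suc n) = prod_encode (g n (lookup n (history g n)), history g n)"

definition cov_rec :: "(nat \<Rightarrow> (nat \<Rightarrow> nat) \<Rightarrow> nat) \<Rightarrow> nat \<Rightarrow> nat" where
  "cov_rec g n = g n (lookup n (history g n))"

lemma lookup_history:
  assumes "m < n"
  shows "lookup n (history g n) m = cov_rec g m"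
proof -
  have psnd_shift: "rec_nat (psnd h) (\<lambda>_. psnd) i = psnd (rec_nat h (\<lambda>_. psnd) i)" for h i
    by (induction i) auto
  have "rec_nat (history g (i + Suc m)) (\<lambda>_. psnd) i = history g (Suc m)" for i
  proof (induction i)
    case (Suc i)
    with psnd_shift[of "history g (Suc i + Suc m)" i] show ?case by simp
  qed simp
  from this[of "n - Suc m"] assms show ?thesis
    by (simp add: lookup_def cov_rec_def)
qed

definition recursive_functional :: "(nat \<Rightarrow> (nat \<Rightarrow> nat) \<Rightarrow> nat) \<Rightarrow> bool" where
  "recursive_functional g \<longleftrightarrow> (\<forall>k a r. total_recursive k a \<longrightarrow>
    (\<forall>b. total_recursive k b \<longrightarrow> total_recursive k (\<lambda>xs. r xs (b xs))) \<longrightarrow>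
    total_recursive k (\<lambda>xs. g (a xs) (r xs)))"

lemma recursive_functionalI:
  "(\<And>k a r. total_recursive k a \<Longrightarrow>
      (\<And>b. total_recursive k b \<Longrightarrow> total_recursive k (\<lambda>xs. r xs (b xs))) \<Longrightarrow>
      total_recursive k (\<lambda>xs. g (a xs) (r xs))) \<Longrightarrow> recursive_functional g"
  unfolding recursive_functional_def by blast

lemma total_recursive_cov_rec:
  assumes "recursive_functional g" "total_recursive k a"
  shows "total_recursive k (\<lambda>xs. cov_rec g (a xs))"
proof -
  have functional_value: "total_recursive k (\<lambda>xs. g (a xs) (r xs))"
    if "total_recursive k a" "\<And>b. total_recursive k b \<Longrightarrow> total_recursive k (\<lambda>xs. r xs (b xs))"
    for k a r
    using assms(1) that unfolding recursive_functional_def by blast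
  have total_recursive_lookup: "total_recursive k (\<lambda>xs. lookup (a xs) (h xs) (b xs))"
    if "total_recursive k a" "total_recursive k h" "total_recursive k b" for k a h b
    unfolding lookup_def by (intro total_recursive_intros that) simp
  have "history g n = rec_nat 0 (\<lambda>m h. prod_encode (g m (lookup m h), h)) n" for n
    by (induction n) auto
  then have cov_rec_eq: "cov_rec g n =
      g n (lookup n (rec_nat 0 (\<lambda>m h. prod_encode (g m (lookup m h), h)) n))" for n
    by (simp add: cov_rec_def)
  show ?thesis
    unfolding cov_rec_eq
    by (intro functional_value total_recursive_lookup total_recursive_intros assms(2)) simp_all
qed


section \<open>Effectiveness of the translation\<close>

lemma even_sort_code: "even (sort_code s) \<longleftrightarrow> is_data s"
  by (cases s) auto

lemma trm_code_map_trm: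
  "(\<And>f. f \<in> funs_trm t \<Longrightarrow> cf (g f) = cf' f) \<Longrightarrow> trm_code cf (map_trm g t) = trm_code cf' t"
proof (induction t)
  case (Fn f ts)
  then have "map (trm_code cf) (map (map_trm g) ts) = map (trm_code cf') ts" by fastforce
  with Fn.prems show ?case by (simp del: map_map map_eq_conv)
qed simp

lemma trm_code_tree_trm:
  assumes "\<And>c i. Sel c i \<notin> funs_trm t"
  shows "trm_code (\<lambda>c. cd_fun_code (Ctor c)) (tree_trm t) = trm_code cd_fun_code t"
proof (rule trm_code_map_trm)
  fix f assume "f \<in> funs_trm t"
  with assms obtain c where "f = Ctor c" by (metis cd_fun.exhaust)
  then show "cd_fun_code (Ctor (ctor_of f)) = cd_fun_code f" by simp
qed

definition verum_code :: nat where
  "verum_code = prod_encode (3, prod_encode (0, 0))"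

definition conj_code :: "nat \<Rightarrow> nat \<Rightarrow> nat" where
  "conj_code a b = prod_encode (4, prod_encode (a, b))"

text \<open>Here \<open>v\<close> is the pair of the code of the sort and the index of a variable.\<close>

definition fin_guard_code :: "nat \<Rightarrow> nat" where
  "fin_guard_code v =
    (if even (pfst v)
     then prod_encode (2, prod_encode (pfst v, Suc (prod_encode (prod_encode (0, v), 0))))
     else verum_code)"

lemma tree_fm_code_simps [simp]:
  "tree_fm_code Falsum = prod_encode (0, 0)"
  "tree_fm_code (Neg \<phi>) = prod_encode (3, tree_fm_code \<phi>)"
  "tree_fm_code (Conj \<phi> \<psi>) = prod_encode (4, prod_encode (tree_fm_code \<phi>, tree_fm_code \<psi>))"
  "tree_fm_code (Disj \<phi> \<psi>) = prod_encode (5, prod_encode (tree_fm_code \<phi>, tree_fm_code \<psi>))"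
  "tree_fm_code (Impl \<phi> \<psi>) = prod_encode (6, prod_encode (tree_fm_code \<phi>, tree_fm_code \<psi>))"
  "tree_fm_code (Forall s x \<phi>) =
    prod_encode (7, prod_encode (prod_encode (sort_code s, x), tree_fm_code \<phi>))"
  "tree_fm_code (Exists s x \<phi>) =
    prod_encode (8, prod_encode (prod_encode (sort_code s, x), tree_fm_code \<phi>))"
  by (simp_all add: tree_fm_code_def)

lemma tree_fm_code_fin_guard:
  "tree_fm_code (fin_guard s x) = fin_guard_code (prod_encode (sort_code s, x))"
  by (simp add: fin_guard_def fin_guard_code_def verum_code_def even_sort_code)
    (simp add: tree_fm_code_def)

lemma total_recursive_conj_code [total_recursive_intros]:
  "total_recursive k a \<Longrightarrow> total_recursive k b \<Longrightarrow> total_recursive k (\<lambda>xs. conj_code (a xs) (b xs))"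
  unfolding conj_code_def by (intro total_recursive_intros)

lemma total_recursive_fin_guard_code [total_recursive_intros]:
  "total_recursive k a \<Longrightarrow> total_recursive k (\<lambda>xs. fin_guard_code (a xs))"
  unfolding fin_guard_code_def by (intro total_recursive_intros)

lemma less_prod_encode: "0 < i \<Longrightarrow> m < prod_encode (i, m)"
  by (cases i) (auto simp: prod_encode_def)

lemma less_prod_encode_fst: "0 < i \<Longrightarrow> a < prod_encode (i, prod_encode (a, b))"
  by (rule le_less_trans[OF le_prod_encode_1 less_prod_encode])

lemma less_prod_encode_snd: "0 < i \<Longrightarrow> b < prod_encode (i, prod_encode (a, b))"
  by (rule le_less_trans[OF le_prod_encode_2 less_prod_encode])

lemmas cov_rec_prod_encode =
  cov_rec_def[of _ "prod_encode _"] lookup_history less_prod_encode less_prod_encode_fst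
  less_prod_encode_snd

text \<open>A number is read both as the code of a term and as the code of a list of terms, and the
  results of both readings are paired, which makes the mutual recursion a simple one.\<close>

definition fin_trm_step :: "nat \<Rightarrow> (nat \<Rightarrow> nat) \<Rightarrow> nat" where
  "fin_trm_step n rec = prod_encode
     (if pfst n = 0 then fin_guard_code (psnd n) else psnd (rec (psnd (psnd n))),
      if n = 0 then verum_code
      else conj_code (pfst (rec (pfst (n - 1)))) (psnd (rec (psnd (n - 1)))))"

definition fin_trm_code :: "nat \<Rightarrow> nat" where
  "fin_trm_code n = pfst (cov_rec fin_trm_step n)"

definition fin_trms_code :: "nat \<Rightarrow> nat" where
  "fin_trms_code n = psnd (cov_rec fin_trm_step n)"

lemma fin_trm_code_simps:
  "fin_trm_code (prod_encode (0, v)) = fin_guard_code v"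
  "fin_trm_code (prod_encode (Suc 0, prod_encode (f, l))) = fin_trms_code l"
  by (simp_all add: fin_trm_code_def fin_trms_code_def cov_rec_prod_encode fin_trm_step_def)

lemma fin_trms_code_simps:
  "fin_trms_code 0 = verum_code"
  "fin_trms_code (Suc (prod_encode (t, l))) = conj_code (fin_trm_code t) (fin_trms_code l)"
  by (simp_all add: fin_trm_code_def fin_trms_code_def cov_rec_def[of _ "Suc _"] cov_rec_def[of _ 0]
      fin_trm_step_def lookup_history less_Suc_eq_le le_prod_encode_1 le_prod_encode_2
      del: history.simps(2))

lemma fin_trms_code_eq:
  "(\<And>t. t \<in> set ts \<Longrightarrow> fin_trm_code (trm_code cf t) = tree_fm_code (fin_trm t)) \<Longrightarrow>
    fin_trms_code (list_encode (map (trm_code cf) ts)) = tree_fm_code (Conjs (map fin_trm ts))"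
  by (induction ts) (simp_all add: fin_trms_code_simps verum_code_def conj_code_def)

lemma fin_trm_code_eq: "fin_trm_code (trm_code cf t) = tree_fm_code (fin_trm t)"
  by (induction t)
    (simp_all add: fin_trm_code_simps fin_trms_code_eq tree_fm_code_fin_guard)

lemma recursive_functional_fin_trm_step: "recursive_functional fin_trm_step"
proof (rule recursive_functionalI)
  fix k a and r :: "nat list \<Rightarrow> nat \<Rightarrow> nat"
  assume [total_recursive_intros]: "total_recursive k a"
    "\<And>b. total_recursive k b \<Longrightarrow> total_recursive k (\<lambda>xs. r xs (b xs))"
  show "total_recursive k (\<lambda>xs. fin_trm_step (a xs) (r xs))"
    unfolding fin_trm_step_def by (intro total_recursive_intros)
qed

lemma total_recursive_fin_trm_code [total_recursive_intros]:
  "total_recursive k a \<Longrightarrow> total_recursive k (\<lambda>xs. fin_trm_code (a xs))"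
  and total_recursive_fin_trms_code [total_recursive_intros]:
  "total_recursive k a \<Longrightarrow> total_recursive k (\<lambda>xs. fin_trms_code (a xs))"
  unfolding fin_trm_code_def fin_trms_code_def
  by (intro total_recursive_pfst total_recursive_psnd total_recursive_cov_rec
      recursive_functional_fin_trm_step; assumption)+

definition fin_fm_step :: "nat \<Rightarrow> (nat \<Rightarrow> nat) \<Rightarrow> nat" where
  "fin_fm_step n rec =
    (let i = pfst n; m = psnd n
     in if i = 0 then verum_code
        else if i = 1 then conj_code (fin_trm_code (pfst m)) (fin_trm_code (psnd m))
        else if i = 2 then fin_trms_code (psnd m)
        else if i = 3 then rec m
        else if i = 7 \<or> i = 8 then rec (psnd m)
        else conj_code (rec (pfst m)) (rec (psnd m)))"

definition fin_fm_code :: "nat \<Rightarrow> nat" where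
  "fin_fm_code = cov_rec fin_fm_step"

lemma fin_fm_code_eq: "fin_fm_code (fm_code cf cp \<phi>) = tree_fm_code (fin_fm \<phi>)"
  by (induction \<phi>)
    (simp_all add: fin_fm_code_def cov_rec_prod_encode fin_fm_step_def fin_trm_code_eq
      fin_trms_code_eq verum_code_def conj_code_def)

lemma recursive_functional_fin_fm_step: "recursive_functional fin_fm_step"
proof (rule recursive_functionalI)
  fix k a and r :: "nat list \<Rightarrow> nat \<Rightarrow> nat"
  assume [total_recursive_intros]: "total_recursive k a"
    "\<And>b. total_recursive k b \<Longrightarrow> total_recursive k (\<lambda>xs. r xs (b xs))"
  show "total_recursive k (\<lambda>xs. fin_fm_step (a xs) (r xs))"
    unfolding fin_fm_step_def Let_def by (intro total_recursive_intros)
qed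

lemma total_recursive_fin_fm_code [total_recursive_intros]:
  "total_recursive k a \<Longrightarrow> total_recursive k (\<lambda>xs. fin_fm_code (a xs))"
  unfolding fin_fm_code_def
  by (intro total_recursive_cov_rec recursive_functional_fin_fm_step)

text \<open>Equations are unchanged, because a constructor and its generator have the same code. The tags
  6 and 4 of an implication and a conjunction serve the two quantifiers, whose tags are 7 and 8.\<close>

definition relativize_step :: "nat \<Rightarrow> (nat \<Rightarrow> nat) \<Rightarrow> nat" where
  "relativize_step n rec =
    (let i = pfst n; m = psnd n
     in if i = 0 \<or> i = 2 then prod_encode (0, 0)
        else if i = 1 then n
        else if i = 3 then prod_encode (3, rec m)
        else if i = 7 \<or> i = 8 then
          prod_encode (i, prod_encode (pfst m,
            prod_encode (if i = 7 then 6 else 4,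
              prod_encode (fin_guard_code (pfst m), rec (psnd m)))))
        else prod_encode (i, prod_encode (rec (pfst m), rec (psnd m))))"

definition relativize_code :: "nat \<Rightarrow> nat" where
  "relativize_code = cov_rec relativize_step"

lemma relativize_code_eq:
  "selector_free \<phi> \<Longrightarrow> relativize_code (cd_fm_code \<phi>) = tree_fm_code (relativize \<phi>)"
proof (induction \<phi>)
  case (Eq t u)
  then show ?case
    by (simp add: relativize_code_def cd_fm_code_def cov_rec_prod_encode relativize_step_def)
      (simp add: tree_fm_code_def trm_code_tree_trm del: cd_fun_code.simps)
qed (simp_all add: relativize_code_def cd_fm_code_def cov_rec_prod_encode relativize_step_def
    tree_fm_code_fin_guard)

lemma recursive_functional_relativize_step: "recursive_functional relativize_step"
proof (rule recursive_functionalI)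
  fix k a and r :: "nat list \<Rightarrow> nat \<Rightarrow> nat"
  assume [total_recursive_intros]: "total_recursive k a"
    "\<And>b. total_recursive k b \<Longrightarrow> total_recursive k (\<lambda>xs. r xs (b xs))"
  show "total_recursive k (\<lambda>xs. relativize_step (a xs) (r xs))"
    unfolding relativize_step_def Let_def by (intro total_recursive_intros)
qed

lemma total_recursive_relativize_code [total_recursive_intros]:
  "total_recursive k a \<Longrightarrow> total_recursive k (\<lambda>xs. relativize_code (a xs))"
  unfolding relativize_code_def
  by (intro total_recursive_cov_rec recursive_functional_relativize_step)

lemma effective_onI:
  assumes "total_recursive 1 (\<lambda>xs. f (xs ! 0))" "\<And>x. x \<in> D \<Longrightarrow> f (code x) = code' (T x)"
  shows "effective_on D code code' T"
proof -
  obtain r where "recf_eval r [n] (f n)" for n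
    using assms(1) unfolding total_recursive_def
    by (metis One_nat_def length_Cons list.size(3) nth_Cons_0)
  with assms(2) show ?thesis unfolding effective_on_def by metis
qed

lemma effective_on_to_tree_fm:
  "effective_on {\<phi>. selector_free \<phi>} cd_fm_code tree_fm_code to_tree_fm"
proof (rule effective_onI)
  show "total_recursive 1
      (\<lambda>xs. conj_code (relativize_code (xs ! 0)) (fin_fm_code (xs ! 0)))"
    by (intro total_recursive_intros) simp_all
  show "conj_code (relativize_code (cd_fm_code \<phi>)) (fin_fm_code (cd_fm_code \<phi>)) =
      tree_fm_code (to_tree_fm \<phi>)" if "\<phi> \<in> {\<phi>. selector_free \<phi>}" for \<phi>
    using that
    by (simp add: relativize_code_eq to_tree_fm_def conj_code_def)
      (simp add: cd_fm_code_def fin_fm_code_eq)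
qed

theorem theorem4:
  shows "\<exists>T :: (cd_fun, unit) fm \<Rightarrow> (nat, sort) fm.
    effective_on {\<phi>. selector_free \<phi>} cd_fm_code tree_fm_code T \<and>
    (\<forall>\<Sigma> \<phi>. cd_signature \<Sigma> \<and> formula_over (cd_language \<Sigma>) \<phi> \<and> selector_free \<phi> \<longrightarrow>
       formula_over (tree_language \<Sigma>) (T \<phi>) \<and>
       (cd_satisfiable \<Sigma> \<phi> \<longleftrightarrow> tree_satisfiable \<Sigma> (T \<phi>)))"
proof -
  have "formula_over (tree_language \<Sigma>) (to_tree_fm \<phi>)"
    "cd_satisfiable \<Sigma> \<phi> \<longleftrightarrow> tree_satisfiable \<Sigma> (to_tree_fm \<phi>)"
    if \<Sigma>: "cd_signature \<Sigma>" and \<phi>: "formula_over (cd_language \<Sigma>) \<phi>" "selector_free \<phi>"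
    for \<Sigma> and \<phi> :: "(cd_fun, unit) fm"
    using formula_over_to_tree_fm[OF \<phi>] tree_satisfiable_if_cd_satisfiable[OF \<Sigma> \<phi>]
      cd_satisfiable_if_tree_satisfiable[OF \<Sigma> \<phi>]
    by blast+
  with effective_on_to_tree_fm show ?thesis by blast
qed

end
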